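(* Fix nonempty finite disjoint product sets $\mathcal J_A$, $\mathcal J_B$ of two merging firms $A$ and $B$, and fix the price responsiveness parameter ($\alpha>0$ under MNL demand, $\sigma>1$ under CES demand). If the pre-merger market shares of the merging firms approach zero (i.e., along any sequence of pricing games and pre-merger Bertrand–Nash equilibria with $s_A\to0$ and $s_B\to 0$), then the merger pass-through matrix converges: $$M\to\varphi I,$$ where $I$ is the identity matrix indexed by $\mathcal J_A\cup\mathcal J_B$, $\varphi=1$ under MNL demand, and $\varphi=\frac{\sigma}{\sigma-1}$ under CES demand.
   Context: Pricing game. A finite set $\mathcal J$ of products is partitioned among firms $f\in\mathcal F$ (including $A$ and $B$) by sets $\mathcal J_f$. Each product $l$ has price $p_l>0$ and constant marginal cost $c_l>0$. Firm $f$'s profit is $\Pi_f(p)=\sum_{l\in\mathcal J_f}(p_l-c_l)q_l(p)$. Demand is $$q_j(p)=\frac{\exp(v_j-\alpha p_j)}{1+\sum_{l\in\mathcal J}\exp(v_l-\alpha p_l)}N\ \ (\text{MNL},\ v_j\in\mathbb R,\ N>0),\qquad q_j(p)=\frac{v_jp_j^{-\sigma}}{1+\sum_{l\in\mathcal J}v_lp_l^{1-\sigma}}Y\ \ (\text{CES},\ v_j>0,\ Y>0).$$ A Bertrand–Nash equilibrium is a price vector at which each firm's own prices maximize its profit given the others' prices (so all firms' first-order conditions hold). $p^{\mathrm{pre}}$ denotes the equilibrium with firms $A$ and $B$ separate. Shares (at $p^{\mathrm{pre}}$). Under MNL, $s_j=q_j/N$ (quantity share); under CES, $s_j=p_jq_j/Y$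 (revenue share). Firm shares are $s_f=\sum_{j\in\mathcal J_f}s_j$. Merger pass-through matrix $M$ (indexed by $\mathcal J_A\cup\mathcal J_B$), defined when the Jacobian below is invertible. MNL: for $j\in\mathcal J_A\cup\mathcal J_B$ let $$h_j(p)=-q_j\Big(\frac{\partial q_j}{\partial p_j}\Big)^{-1}-(p_j-c_j)-\sum_{l\in(\mathcal J_A\cup\mathcal J_B)\setminus\{j\}}(p_l-c_l)\frac{\partial q_l}{\partial p_j}\Big(\frac{\partial q_j}{\partial p_j}\Big)^{-1},$$ so that $h=0$ is the merged firm's first-order condition; $M=-\big(\partial h_j/\partial p_k\big)_{j,k\in\mathcal J_A\cup\mathcal J_B}^{-1}$ at $p^{\mathrm{pre}}$. CES: with $\tilde p_j=\log p_j$, $m_j=(p_j-c_j)/p_j$, $\varepsilon_{jj}=(\partial q_j/\partial p_j)(p_j/q_j)$, $R_j=p_jq_j$, $D^R_{j\to l}=-(\partial R_l/\partial p_j)/(\partial R_j/\partial p_j)$, let $$h_j(\tilde p)=-\varepsilon_{jj}^{-1}-m_j+(1+\varepsilon_{jj}^{-1})\sum_{l\in(\mathcal J_A\cup\mathcal J_B)\setminus\{j\}}m_lD^R_{j\to l};$$ $M=-\big(\partial h_j/\partial\tilde p_k\big)_{j,k\in\mathcal J_A\cup\mathcal J_B}^{-1}$ at $\tilde p^{\mathrm{pre}}$. *)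

theory Defs
  imports "HOL-Analysis.Analysis"
begin

text \<open>
  The field \<open>quality\<close> holds the demand parameters $v_j$, and \<open>market_size\<close> is $N$ under MNL and
  $Y$ under CES. Price vectors are total functions on the type of products; only
  their values on \<open>products G\<close> matter.
\<close>

record ('j, 'f) pricing_game =
  products :: "'j set"
  firms :: "'f set"
  owned :: "'f \<Rightarrow> 'j set"
  cost :: "'j \<Rightarrow> real"
  quality :: "'j \<Rightarrow> real"
  market_size :: real

definition wf_game :: "('j, 'f) pricing_game \<Rightarrow> bool" where
  "wf_game G \<longleftrightarrow>
     finite (products G) \<and>
     disjoint_family_on (owned G) (firms G) \<and>
     (\<Union>f\<in>firms G. owned G f) = products G \<and>
     (\<forall>l\<in>products G. 0 < cost G l) \<and>
     0 < market_size G"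

definition mnl_demand :: "real \<Rightarrow> ('j, 'f) pricing_game \<Rightarrow> 'j \<Rightarrow> ('j \<Rightarrow> real) \<Rightarrow> real" where
  "mnl_demand \<alpha> G j p =
     exp (quality G j - \<alpha> * p j) / (1 + (\<Sum>l\<in>products G. exp (quality G l - \<alpha> * p l)))
       * market_size G"

definition ces_demand :: "real \<Rightarrow> ('j, 'f) pricing_game \<Rightarrow> 'j \<Rightarrow> ('j \<Rightarrow> real) \<Rightarrow> real" where
  "ces_demand \<sigma> G j p =
     quality G j * p j powr (- \<sigma>)
       / (1 + (\<Sum>l\<in>products G. quality G l * p l powr (1 - \<sigma>)))
       * market_size G"

text \<open>In the following definitions \<open>q\<close> is the demand system: \<open>q j p\<close> is the quantity of
  product \<open>j\<close> at prices \<open>p\<close>.\<close>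

definition profit ::
  "('j \<Rightarrow> ('j \<Rightarrow> real) \<Rightarrow> real) \<Rightarrow> ('j, 'f) pricing_game \<Rightarrow> 'f \<Rightarrow> ('j \<Rightarrow> real) \<Rightarrow> real" where
  "profit q G f p = (\<Sum>l\<in>owned G f. (p l - cost G l) * q l p)"

definition bertrand_nash ::
  "('j \<Rightarrow> ('j \<Rightarrow> real) \<Rightarrow> real) \<Rightarrow> ('j, 'f) pricing_game \<Rightarrow> ('j \<Rightarrow> real) \<Rightarrow> bool" where
  "bertrand_nash q G p \<longleftrightarrow>
     (\<forall>l\<in>products G. 0 < p l) \<and>
     (\<forall>f\<in>firms G. \<forall>p'.
        (\<forall>l\<in>products G. 0 < p' l) \<and> (\<forall>l\<in>products G - owned G f. p' l = p l)
          \<longrightarrow> profit q G f p' \<le> profit q G f p)"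

definition mnl_share ::
  "real \<Rightarrow> ('j, 'f) pricing_game \<Rightarrow> ('j \<Rightarrow> real) \<Rightarrow> 'j \<Rightarrow> real" where
  "mnl_share \<alpha> G p j = mnl_demand \<alpha> G j p / market_size G"

definition ces_share ::
  "real \<Rightarrow> ('j, 'f) pricing_game \<Rightarrow> ('j \<Rightarrow> real) \<Rightarrow> 'j \<Rightarrow> real" where
  "ces_share \<sigma> G p j = p j * ces_demand \<sigma> G j p / market_size G"

definition mnl_firm_share ::
  "real \<Rightarrow> ('j, 'f) pricing_game \<Rightarrow> ('j \<Rightarrow> real) \<Rightarrow> 'f \<Rightarrow> real" where
  "mnl_firm_share \<alpha> G p f = (\<Sum>j\<in>owned G f. mnl_share \<alpha> G p j)"

definition ces_firm_share ::
  "real \<Rightarrow> ('j, 'f) pricing_game \<Rightarrow> ('j \<Rightarrow> real) \<Rightarrow> 'f \<Rightarrow> real" where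
  "ces_firm_share \<sigma> G p f = (\<Sum>j\<in>owned G f. ces_share \<sigma> G p j)"

definition partial :: "(('j \<Rightarrow> real) \<Rightarrow> real) \<Rightarrow> 'j \<Rightarrow> ('j \<Rightarrow> real) \<Rightarrow> real" where
  "partial F k p = deriv (\<lambda>x. F (p(k := x))) (p k)"

text \<open>Below, \<open>S\<close> is the product set of the merged firm.\<close>

definition mnl_foc ::
  "real \<Rightarrow> ('j, 'f) pricing_game \<Rightarrow> 'j set \<Rightarrow> 'j \<Rightarrow> ('j \<Rightarrow> real) \<Rightarrow> real" where
  "mnl_foc \<alpha> G S j p =
     (let q = mnl_demand \<alpha> G in
       - q j p * inverse (partial (q j) j p)
       - (p j - cost G j)
       - (\<Sum>l\<in>S - {j}. (p l - cost G l) * partial (q l) j p * inverse (partial (q j) j p)))"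

definition ces_revenue :: "real \<Rightarrow> ('j, 'f) pricing_game \<Rightarrow> 'j \<Rightarrow> ('j \<Rightarrow> real) \<Rightarrow> real" where
  "ces_revenue \<sigma> G j p = p j * ces_demand \<sigma> G j p"

definition ces_own_elasticity ::
  "real \<Rightarrow> ('j, 'f) pricing_game \<Rightarrow> 'j \<Rightarrow> ('j \<Rightarrow> real) \<Rightarrow> real" where
  "ces_own_elasticity \<sigma> G j p =
     partial (ces_demand \<sigma> G j) j p * (p j / ces_demand \<sigma> G j p)"

definition rel_margin :: "('j, 'f) pricing_game \<Rightarrow> 'j \<Rightarrow> ('j \<Rightarrow> real) \<Rightarrow> real" where
  "rel_margin G j p = (p j - cost G j) / p j"

definition ces_revenue_diversion ::
  "real \<Rightarrow> ('j, 'f) pricing_game \<Rightarrow> 'j \<Rightarrow> 'j \<Rightarrow> ('j \<Rightarrow> real) \<Rightarrow> real" where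
  "ces_revenue_diversion \<sigma> G j l p =
     - partial (ces_revenue \<sigma> G l) j p / partial (ces_revenue \<sigma> G j) j p"

definition ces_foc ::
  "real \<Rightarrow> ('j, 'f) pricing_game \<Rightarrow> 'j set \<Rightarrow> 'j \<Rightarrow> ('j \<Rightarrow> real) \<Rightarrow> real" where
  "ces_foc \<sigma> G S j p =
     - inverse (ces_own_elasticity \<sigma> G j p)
     - rel_margin G j p
     + (1 + inverse (ces_own_elasticity \<sigma> G j p))
       * (\<Sum>l\<in>S - {j}. rel_margin G l p * ces_revenue_diversion \<sigma> G j l p)"

text \<open>
  A matrix indexed by a finite set of products is represented by a library matrix over a
  finite index type \<open>'m\<close>, whose elements label the products via an injection \<open>e\<close>; the merged
  firm's product set is then \<open>range e\<close>.
\<close>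

definition mnl_jacobian ::
  "real \<Rightarrow> ('j, 'f) pricing_game \<Rightarrow> ('m::finite \<Rightarrow> 'j) \<Rightarrow> ('j \<Rightarrow> real) \<Rightarrow> real^'m^'m" where
  "mnl_jacobian \<alpha> G e p = (\<chi> i k. partial (mnl_foc \<alpha> G (range e) (e i)) (e k) p)"

text \<open>Under CES, differentiation is with respect to log prices, at the log of \<open>p\<close>.\<close>

definition ces_jacobian ::
  "real \<Rightarrow> ('j, 'f) pricing_game \<Rightarrow> ('m::finite \<Rightarrow> 'j) \<Rightarrow> ('j \<Rightarrow> real) \<Rightarrow> real^'m^'m" where
  "ces_jacobian \<sigma> G e p =
     (\<chi> i k. partial (\<lambda>t. ces_foc \<sigma> G (range e) (e i) (\<lambda>l. exp (t l))) (e k) (\<lambda>l. ln (p l)))"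

definition mnl_pass_through ::
  "real \<Rightarrow> ('j, 'f) pricing_game \<Rightarrow> ('m::finite \<Rightarrow> 'j) \<Rightarrow> ('j \<Rightarrow> real) \<Rightarrow> real^'m^'m" where
  "mnl_pass_through \<alpha> G e p = - matrix_inv (mnl_jacobian \<alpha> G e p)"

definition ces_pass_through ::
  "real \<Rightarrow> ('j, 'f) pricing_game \<Rightarrow> ('m::finite \<Rightarrow> 'j) \<Rightarrow> ('j \<Rightarrow> real) \<Rightarrow> real^'m^'m" where
  "ces_pass_through \<sigma> G e p = - matrix_inv (ces_jacobian \<sigma> G e p)"

end

theory Submission
  imports Defs
begin

text \<open>
  The first-order conditions of a firm with share \<open>s\<close> force a common margin on all its products:
  absolute and equal to \<open>1 / (\<alpha> (1 - s))\<close> under MNL, relative and equal to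
  \<open>1 / (\<sigma> - (\<sigma> - 1) s)\<close> under CES. So margins stay bounded as the shares vanish. In the Jacobian of
  \<open>h\<close>, every term except the derivative of the own margin carries a share as a factor, while
  that derivative tends to \<open>1\<close> (MNL, price) or \<open>1 - 1 / \<sigma>\<close> (CES, log price). Hence the
  Jacobian tends to a nonzero multiple of \<open>-I\<close>, and matrix inversion is continuous there by Cramer's rule.
\<close>

lemma sum_of_bool_eq_mult:
  fixes f :: "'a \<Rightarrow> real"
  assumes "finite A" "k \<in> A"
  shows "(\<Sum>i\<in>A. of_bool (i = k) * f i) = f k"
  using assms by (simp add: sum.remove)

section \<open>Continuity of matrix inversion\<close>

lemma matrix_inv_mult:
  fixes A :: "real^'m^'m"
  assumes "invertible A"
  shows "A ** matrix_inv A = mat 1" "matrix_inv A ** A = mat 1"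
  using someI_ex[OF assms[unfolded invertible_def]] by (auto simp: matrix_inv_def)

text \<open>Column \<open>k\<close> of the inverse solves the linear system with right-hand side
  \<open>axis k 1\<close>, to which Cramer's rule applies. This writes each entry as a quotient of
  two polynomials in the entries of \<open>A\<close>, the form in which limits can be taken.\<close>

lemma matrix_inv_cofactor:
  fixes A :: "real^'m^'m"
  assumes "invertible A"
  shows "matrix_inv A $ i $ k =
    det (\<chi> r c. if c = i then axis k 1 $ r else A $ r $ c) / det A"
proof -
  have "A *v (matrix_inv A *v axis k 1) = axis k 1"
    using assms by (simp add: matrix_vector_mul_assoc matrix_inv_mult)
  then have "matrix_inv A *v axis k 1 =
    (\<chi> i. det (\<chi> r c. if c = i then axis k 1 $ r else A $ r $ c) / det A)"
    using cramer[of A] assms by (simp add: invertible_det_nz)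
  then show ?thesis
    by (simp add: vec_eq_iff matrix_vector_mult_basis column_def)
qed

lemma tendsto_det:
  fixes F :: "'a \<Rightarrow> real^'m^'m"
  assumes "(F \<longlongrightarrow> A) net"
  shows "((\<lambda>n. det (F n)) \<longlongrightarrow> det A) net"
  unfolding det_def by (intro tendsto_intros assms)

lemma tendsto_matrix_inv:
  fixes F :: "'a \<Rightarrow> real^'m^'m"
  assumes F: "(F \<longlongrightarrow> A) net" and A: "invertible A"
  shows "\<forall>\<^sub>F n in net. invertible (F n)"
    and "((\<lambda>n. matrix_inv (F n)) \<longlongrightarrow> matrix_inv A) net"
proof -
  have dA: "det A \<noteq> 0" using A invertible_det_nz by blast
  show ev: "\<forall>\<^sub>F n in net. invertible (F n)"
    using tendsto_imp_eventually_ne[OF tendsto_det[OF F] dA] by (simp add: invertible_det_nz)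
  show "((\<lambda>n. matrix_inv (F n)) \<longlongrightarrow> matrix_inv A) net"
  proof (intro vec_tendstoI)
    fix i k
    have "((\<lambda>n. det (\<chi> r c. if c = i then axis k 1 $ r else F n $ r $ c) / det (F n))
      \<longlongrightarrow> det (\<chi> r c. if c = i then axis k 1 $ r else A $ r $ c) / det A) net"
    proof (intro tendsto_divide tendsto_det F dA vec_tendstoI)
      fix r c
      show "((\<lambda>n. (\<chi> r c. if c = i then axis k 1 $ r else F n $ r $ c) $ r $ c)
        \<longlongrightarrow> (\<chi> r c. if c = i then axis k 1 $ r else A $ r $ c) $ r $ c) net"
        by (cases "c = i") (auto intro!: tendsto_intros F)
    qed
    \<comment> \<open>The quotient of determinants equals the entry of
      \<open>matrix_inv (F n)\<close> only where \<open>F n\<close> is invertible, hence the passage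
      to an eventual equality.\<close>
    then show "((\<lambda>n. matrix_inv (F n) $ i $ k) \<longlongrightarrow> matrix_inv A $ i $ k) net"
      unfolding matrix_inv_cofactor[OF A]
      by (rule Lim_transform_eventually)
        (use ev in eventually_elim, simp add: matrix_inv_cofactor)
  qed
qed

lemma matrix_inv_scaleR_mat:
  assumes "\<mu> \<noteq> 0"
  shows "invertible (\<mu> *\<^sub>R mat 1 :: real^'m^'m)"
    and "matrix_inv (\<mu> *\<^sub>R mat 1 :: real^'m^'m) = inverse \<mu> *\<^sub>R mat 1"
proof -
  have *: "(\<mu> *\<^sub>R mat 1) ** (inverse \<mu> *\<^sub>R mat 1 :: real^'m^'m) = mat 1"
    "(inverse \<mu> *\<^sub>R mat 1) ** (\<mu> *\<^sub>R mat 1 :: real^'m^'m) = mat 1"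
    using assms by (simp_all flip: scalar_matrix_assoc matrix_scalar_ac)
  show "invertible (\<mu> *\<^sub>R mat 1 :: real^'m^'m)"
    using * invertible_def by blast
  then show "matrix_inv (\<mu> *\<^sub>R mat 1 :: real^'m^'m) = inverse \<mu> *\<^sub>R mat 1"
    using * by (metis matrix_inv_mult(2) matrix_mul_assoc matrix_mul_lid matrix_mul_rid)
qed

section \<open>Shares of logit form\<close>

text \<open>Moving one variable changes only the weight \<open>W k\<close>, at logarithmic rate
  \<open>\<eta>\<close>: this is \<open>- \<alpha>\<close> for prices under MNL and
  \<open>(1 - \<sigma>) / p k\<close> for prices under CES. The quotient rule then gives one
  derivative law for both models.\<close>

lemma DERIV_logit_share:
  fixes W :: "'j \<Rightarrow> real \<Rightarrow> real"
  assumes "finite P" "k \<in> P" "l \<in> P"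
    and W: "\<And>l. l \<in> P \<Longrightarrow> (W l has_real_derivative of_bool (l = k) * (\<eta> * W k x)) (at x)"
    and nonneg: "\<And>l. l \<in> P \<Longrightarrow> 0 \<le> W l x"
  shows "((\<lambda>y. W l y / (1 + (\<Sum>i\<in>P. W i y))) has_real_derivative
    \<eta> * (W l x / (1 + (\<Sum>i\<in>P. W i x))) *
      (of_bool (l = k) - W k x / (1 + (\<Sum>i\<in>P. W i x)))) (at x)"
proof -
  let ?D = "1 + (\<Sum>i\<in>P. W i x)"
  have D: "?D \<noteq> 0"
    using sum_nonneg[of P "\<lambda>i. W i x"] nonneg by force
  have "(\<Sum>i\<in>P. of_bool (i = k) * (\<eta> * W k x)) = \<eta> * W k x"
    using assms(1,2) by (rule sum_of_bool_eq_mult)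
  moreover have "((\<lambda>y. \<Sum>i\<in>P. W i y) has_real_derivative
      (\<Sum>i\<in>P. of_bool (i = k) * (\<eta> * W k x))) (at x)"
    by (intro DERIV_sum W)
  ultimately have sum: "((\<lambda>y. \<Sum>i\<in>P. W i y) has_real_derivative \<eta> * W k x) (at x)"
    by simp
  have "((\<lambda>y. W l y / (1 + (\<Sum>i\<in>P. W i y))) has_real_derivative
    (of_bool (l = k) * (\<eta> * W k x) * ?D - W l x * (\<eta> * W k x)) / (?D * ?D)) (at x)"
    using DERIV_divide[OF W[OF \<open>l \<in> P\<close>] DERIV_add[OF DERIV_const sum] D] by simp
  then show ?thesis
    by (rule back_subst[where P = "\<lambda>d. (_ has_real_derivative d) _"])
      (use D in \<open>auto simp: field_simps\<close>)
qed

text \<open>The summand 1 in the denominator is the outside option, which always keeps a positive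
  share. The strict bound later keeps all denominators in the margin formulas away from
  zero.\<close>

lemma sum_logit_share_less_1:
  fixes w :: "'j \<Rightarrow> real"
  assumes "finite P" "F \<subseteq> P" "\<And>l. l \<in> P \<Longrightarrow> 0 \<le> w l"
  shows "(\<Sum>l\<in>F. w l / (1 + sum w P)) < 1"
proof -
  have "0 \<le> sum w P" "sum w F \<le> sum w P"
    using assms by (auto intro: sum_nonneg sum_mono2)
  then show ?thesis by (simp flip: sum_divide_distrib)
qed

section \<open>The first-order condition common to both models, and its Jacobian\<close>

text \<open>With margins \<open>m\<close> and shares \<open>s\<close>, the first-order condition of the merged firm has this form
  in both models: \<open>(a, b, c)\<close> is \<open>(1 / \<alpha>, 1, 1)\<close> under MNL, with absolute margins, and
  \<open>(1, \<sigma> - 1, \<sigma>)\<close> under CES, with relative margins.\<close>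

definition markup_gap ::
  "real \<Rightarrow> real \<Rightarrow> real \<Rightarrow> 'j set \<Rightarrow> ('j \<Rightarrow> real) \<Rightarrow> ('j \<Rightarrow> real) \<Rightarrow> 'j \<Rightarrow> real" where
  "markup_gap a b c S m s j = (a + b * (\<Sum>l\<in>S - {j}. m l * s l)) / (c - b * s j) - m j"

text \<open>The quotient-rule derivative of \<open>markup_gap\<close> in variable \<open>k\<close>,
  with the logit law of rate \<open>\<eta>\<close> substituted for the share derivatives and
  \<open>\<mu> l\<close> for the derivative of margin \<open>l\<close> in its own variable.\<close>

definition markup_slope ::
  "real \<Rightarrow> real \<Rightarrow> real \<Rightarrow> 'j set \<Rightarrow> ('j \<Rightarrow> real) \<Rightarrow> ('j \<Rightarrow> real) \<Rightarrow> real \<Rightarrow> ('j \<Rightarrow> real)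
    \<Rightarrow> 'j \<Rightarrow> 'j \<Rightarrow> real" where
  "markup_slope a b c S m s \<eta> \<mu> j k =
    (b * (\<Sum>l\<in>S - {j}. of_bool (l = k) * \<mu> l * s l + \<eta> * s l * (of_bool (l = k) - s k) * m l)
        * (c - b * s j)
      + (a + b * (\<Sum>l\<in>S - {j}. m l * s l)) * (b * (\<eta> * s j * (of_bool (j = k) - s k))))
      / (c - b * s j)\<^sup>2
    - of_bool (j = k) * \<mu> j"

lemma DERIV_markup_gap:
  assumes "j \<in> S"
    and s: "\<And>l. l \<in> S \<Longrightarrow>
      ((\<lambda>y. s y l) has_real_derivative \<eta> * s x l * (of_bool (l = k) - s x k)) (at x)"
    and m: "\<And>l. l \<in> S \<Longrightarrow> ((\<lambda>y. m y l) has_real_derivative of_bool (l = k) * \<mu> l) (at x)"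
    and "c - b * s x j \<noteq> 0"
  shows "((\<lambda>y. markup_gap a b c S (m y) (s y) j) has_real_derivative
    markup_slope a b c S (m x) (s x) \<eta> \<mu> j k) (at x)"
proof -
  have "((\<lambda>y. \<Sum>l\<in>S - {j}. m y l * s y l) has_real_derivative
      (\<Sum>l\<in>S - {j}. of_bool (l = k) * \<mu> l * s x l
        + \<eta> * s x l * (of_bool (l = k) - s x k) * m x l)) (at x)"
    by (intro DERIV_sum DERIV_mult s m) auto
  then show ?thesis
    unfolding markup_gap_def markup_slope_def
    using assms(1,4)
    by - (rule derivative_eq_intros s m refl | assumption | simp add: power2_eq_square)+
qed

text \<open>Convergent factors times vanishing shares vanish, including the term of the sum with
  \<open>l = k\<close>, and the denominator tends to the square of \<open>c\<close>. Only the
  derivative of the own margin survives.\<close>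

lemma tendsto_markup_slope:
  fixes m s :: "nat \<Rightarrow> 'j \<Rightarrow> real"
  assumes "j \<in> S" "k \<in> S" "c \<noteq> 0"
    and s: "\<And>l. l \<in> S \<Longrightarrow> (\<lambda>n. s n l) \<longlonglongrightarrow> 0"
    and m: "\<And>l. l \<in> S \<Longrightarrow> (\<lambda>n. m n l) \<longlonglongrightarrow> m'"
    and \<mu>: "\<And>l. l \<in> S \<Longrightarrow> (\<lambda>n. \<mu> n l) \<longlonglongrightarrow> \<mu>'"
  shows "(\<lambda>n. markup_slope a b c S (m n) (s n) \<eta> (\<mu> n) j k) \<longlonglongrightarrow> - of_bool (j = k) * \<mu>'"
proof -
  have 1: "(\<lambda>n. \<Sum>l\<in>S - {j}. of_bool (l = k) * \<mu> n l * s n l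
        + \<eta> * s n l * (of_bool (l = k) - s n k) * m n l) \<longlonglongrightarrow> (\<Sum>l\<in>S - {j}. 0)"
    by (intro tendsto_sum) (auto intro!: tendsto_eq_intros s m \<mu> assms)
  have 2: "(\<lambda>n. \<Sum>l\<in>S - {j}. m n l * s n l) \<longlonglongrightarrow> (\<Sum>l\<in>S - {j}. 0)"
    by (intro tendsto_sum) (auto intro!: tendsto_eq_intros s m)
  show ?thesis
    unfolding markup_slope_def
    by (rule tendsto_eq_intros 1 2 s \<mu> assms refl | simp add: assms)+
qed

text \<open>By injectivity of \<open>e\<close>, the indicator of \<open>e i = e k\<close> is the
  identity matrix over the index type. Since all products share the limit \<open>\<mu>'\<close>, the
  Jacobian tends to a scalar matrix, which can be inverted explicitly.\<close>

lemma pass_through_limit: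
  fixes m s :: "nat \<Rightarrow> 'j \<Rightarrow> real" and e :: "'m::finite \<Rightarrow> 'j" and J :: "nat \<Rightarrow> real^'m^'m"
  assumes "c \<noteq> 0" "\<mu>' \<noteq> 0" "inj e"
    and "\<And>l. l \<in> range e \<Longrightarrow> (\<lambda>n. s n l) \<longlonglongrightarrow> 0"
    and "\<And>l. l \<in> range e \<Longrightarrow> (\<lambda>n. m n l) \<longlonglongrightarrow> m'"
    and "\<And>l. l \<in> range e \<Longrightarrow> (\<lambda>n. \<mu> n l) \<longlonglongrightarrow> \<mu>'"
    and J: "\<And>n i k. J n $ i $ k = markup_slope a b c (range e) (m n) (s n) \<eta> (\<mu> n) (e i) (e k)"
  shows "(\<forall>\<^sub>F n in sequentially. invertible (J n)) \<and>
    (\<lambda>n. - matrix_inv (J n)) \<longlonglongrightarrow> (1 / \<mu>') *\<^sub>R mat 1"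
proof -
  have lim: "J \<longlonglongrightarrow> (- \<mu>') *\<^sub>R mat 1"
  proof (intro vec_tendstoI)
    fix i k
    have "(\<lambda>n. J n $ i $ k) \<longlonglongrightarrow> - of_bool (e i = e k) * \<mu>'"
      unfolding J by (intro tendsto_markup_slope) (use assms in auto)
    then show "(\<lambda>n. J n $ i $ k) \<longlonglongrightarrow> ((- \<mu>') *\<^sub>R mat 1) $ i $ k"
      using \<open>inj e\<close> by (cases "i = k") (simp_all add: mat_def inj_eq)
  qed
  note inv = matrix_inv_scaleR_mat[of "- \<mu>'", where 'm = 'm]
  have "(\<lambda>n. - matrix_inv (J n)) \<longlonglongrightarrow> - (inverse (- \<mu>') *\<^sub>R mat 1)"
    using tendsto_minus[OF tendsto_matrix_inv(2)[OF lim]] inv assms(2) by simp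
  then show ?thesis
    using tendsto_matrix_inv(1)[OF lim] inv assms(2) by (simp add: inverse_eq_divide)
qed

section \<open>Equilibrium first-order conditions of a single firm\<close>

text \<open>The right-hand side of the condition is the same for every product of the firm, so all
  margins coincide. The sum is then the common margin times the firm share, and a scalar linear
  equation remains.\<close>

lemma common_margin:
  fixes m s :: "'j \<Rightarrow> real"
  assumes "\<And>j. j \<in> F \<Longrightarrow> c * m j = a + b * (\<Sum>l\<in>F. m l * s l)"
    and "c \<noteq> 0" "c - b * sum s F \<noteq> 0" "j \<in> F"
  shows "m j = a / (c - b * sum s F)"
proof -
  have eq: "m l = m j" if "l \<in> F" for l
    using assms(1)[OF that] assms(1)[OF \<open>j \<in> F\<close>] \<open>c \<noteq> 0\<close> by (metis mult_left_cancel)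
  have "(\<Sum>l\<in>F. m l * s l) = m j * sum s F"
    unfolding sum_distrib_left by (rule sum.cong) (simp_all add: eq)
  then have "m j * (c - b * sum s F) = a"
    using assms(1)[OF \<open>j \<in> F\<close>] by (simp add: algebra_simps)
  then show ?thesis
    using assms(3) by (simp add: field_simps)
qed

lemma wf_game_finite: "wf_game G \<Longrightarrow> finite (products G)"
  and wf_game_market_size: "wf_game G \<Longrightarrow> 0 < market_size G"
  and wf_game_owned: "wf_game G \<Longrightarrow> f \<in> firms G \<Longrightarrow> owned G f \<subseteq> products G"
  by (auto simp: wf_game_def)

lemma DERIV_margin:
  "((\<lambda>x. (p(k := x)) l - cost G l) has_real_derivative of_bool (l = k)) (at x)"
  by (cases "l = k") (auto intro!: derivative_eq_intros)

lemma nash_profit_deriv_zero: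
  assumes nash: "bertrand_nash q G p" and "f \<in> firms G" "j \<in> owned G f" "owned G f \<subseteq> products G"
    and deriv: "((\<lambda>x. profit q G f (p(j := x))) has_real_derivative d) (at (p j))"
  shows "d = 0"
proof (rule DERIV_local_max[OF deriv])
  \<comment> \<open>The radius required by \<open>DERIV_local_max\<close> is taken to be
    \<open>p j\<close>, so that every deviating price within it is positive and hence
    admissible.\<close>
  show "0 < p j"
    using assms by (auto simp: bertrand_nash_def)
  show "\<forall>y. \<bar>p j - y\<bar> < p j \<longrightarrow> profit q G f (p(j := y)) \<le> profit q G f (p(j := p j))"
  proof (intro allI impI)
    fix y assume "\<bar>p j - y\<bar> < p j"
    then have "0 < y" by linarith
    then show "profit q G f (p(j := y)) \<le> profit q G f (p(j := p j))"
      using assms by (auto simp: bertrand_nash_def)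
  qed
qed

text \<open>In both models profit is market size times the sum of margin times share, with absolute
  margins under MNL and relative ones under CES. The factor \<open>N * s x j\<close> separates off,
  so at an equilibrium the bracket must vanish, which leads to the hypothesis of
  \<open>common_margin\<close>.\<close>

lemma DERIV_margin_times_share:
  fixes m s :: "real \<Rightarrow> 'j \<Rightarrow> real"
  assumes "finite F" "j \<in> F"
    and s: "\<And>l. l \<in> F \<Longrightarrow>
      ((\<lambda>y. s y l) has_real_derivative \<eta> * s x l * (of_bool (l = j) - s x j)) (at x)"
    and m: "\<And>l. l \<in> F \<Longrightarrow> ((\<lambda>y. m y l) has_real_derivative of_bool (l = j) * \<mu>) (at x)"
  shows "((\<lambda>y. N * (\<Sum>l\<in>F. m y l * s y l)) has_real_derivative
    N * s x j * (\<mu> + \<eta> * m x j - \<eta> * (\<Sum>l\<in>F. m x l * s x l))) (at x)"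
proof -
  have "((\<lambda>y. N * (\<Sum>l\<in>F. m y l * s y l)) has_real_derivative
    N * (\<Sum>l\<in>F. of_bool (l = j) * \<mu> * s x l + \<eta> * s x l * (of_bool (l = j) - s x j) * m x l)) (at x)"
    by (intro DERIV_cmult DERIV_sum DERIV_mult s m)
  also have "(\<Sum>l\<in>F. of_bool (l = j) * \<mu> * s x l + \<eta> * s x l * (of_bool (l = j) - s x j) * m x l)
    = (\<Sum>l\<in>F. of_bool (l = j) * (s x l * (\<mu> + \<eta> * m x l)) - s x j * \<eta> * (m x l * s x l))"
    by (rule sum.cong) (auto simp: algebra_simps)
  also have "\<dots> = s x j * (\<mu> + \<eta> * m x j) - s x j * \<eta> * (\<Sum>l\<in>F. m x l * s x l)"
    using assms(1,2)
    by (simp add: sum_subtractf sum_distrib_left sum_of_bool_eq_mult del: of_bool_eq)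
  finally show ?thesis
    by (simp add: algebra_simps)
qed

section \<open>MNL demand: Jacobian and equilibrium margins\<close>

lemma mnl_demand_eq_share:
  "wf_game G \<Longrightarrow> mnl_demand \<alpha> G j p = market_size G * mnl_share \<alpha> G p j"
  using wf_game_market_size[of G] by (simp add: mnl_share_def)

lemma mnl_share_eq:
  "wf_game G \<Longrightarrow> mnl_share \<alpha> G p j =
    exp (quality G j - \<alpha> * p j) / (1 + (\<Sum>l\<in>products G. exp (quality G l - \<alpha> * p l)))"
  using wf_game_market_size[of G] by (simp add: mnl_share_def mnl_demand_def)

lemma mnl_share_pos: "wf_game G \<Longrightarrow> 0 < mnl_share \<alpha> G p j"
  by (auto simp: mnl_share_eq intro!: divide_pos_pos add_pos_nonneg sum_nonneg)

lemma sum_mnl_share_less_1: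
  assumes "wf_game G" "F \<subseteq> products G"
  shows "(\<Sum>l\<in>F. mnl_share \<alpha> G p l) < 1"
  unfolding mnl_share_eq[OF assms(1)]
  by (rule sum_logit_share_less_1) (use assms wf_game_finite in auto)

lemma mnl_share_less_1:
  "wf_game G \<Longrightarrow> l \<in> products G \<Longrightarrow> mnl_share \<alpha> G p l < 1"
  using sum_mnl_share_less_1[of G "{l}"] by simp

lemma DERIV_mnl_share:
  assumes "wf_game G" "k \<in> products G" "l \<in> products G"
  shows "((\<lambda>x. mnl_share \<alpha> G (p(k := x)) l) has_real_derivative
    - \<alpha> * mnl_share \<alpha> G p l * (of_bool (l = k) - mnl_share \<alpha> G p k)) (at (p k))"
proof -
  have "((\<lambda>x. exp (quality G l - \<alpha> * (p(k := x)) l)) has_real_derivative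
    of_bool (l = k) * (- \<alpha> * exp (quality G k - \<alpha> * (p(k := p k)) k))) (at (p k))" for l
    by (cases "l = k") (auto intro!: derivative_eq_intros)
  from DERIV_logit_share[OF wf_game_finite[OF assms(1)] assms(2,3) this]
  show ?thesis
    using assms(1) by (simp add: mnl_share_eq)
qed

lemma partial_mnl_demand:
  assumes "wf_game G" "k \<in> products G" "l \<in> products G"
  shows "partial (mnl_demand \<alpha> G l) k p =
    market_size G * (- \<alpha> * mnl_share \<alpha> G p l * (of_bool (l = k) - mnl_share \<alpha> G p k))"
  unfolding partial_def mnl_demand_eq_share[OF assms(1)]
  by (intro DERIV_imp_deriv DERIV_cmult DERIV_mnl_share assms)

text \<open>Market size, \<open>\<alpha>\<close> and the own share cancel in the ratio of cross to
  own slope, leaving minus the share of \<open>l\<close> over one minus the share of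
  \<open>j\<close>. The identity holds at every price vector, so it may be differentiated
  directly.\<close>

lemma mnl_foc_eq_markup_gap:
  assumes G: "wf_game G" and S: "S \<subseteq> products G" "j \<in> S" and "\<alpha> \<noteq> 0"
  shows "mnl_foc \<alpha> G S j p =
    markup_gap (1 / \<alpha>) 1 1 S (\<lambda>l. p l - cost G l) (mnl_share \<alpha> G p) j"
proof -
  have j: "j \<in> products G" using S by auto
  note nz = wf_game_market_size[OF G] mnl_share_pos[OF G, of \<alpha> p j]
    mnl_share_less_1[OF G j, of \<alpha> p] \<open>\<alpha> \<noteq> 0\<close>
  have "(\<Sum>l\<in>S - {j}. (p l - cost G l) * partial (mnl_demand \<alpha> G l) j p
      * inverse (partial (mnl_demand \<alpha> G j) j p))
    = (\<Sum>l\<in>S - {j}. - ((p l - cost G l) * mnl_share \<alpha> G p l / (1 - mnl_share \<alpha> G p j)))"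
  proof (rule sum.cong)
    fix l assume "l \<in> S - {j}"
    then show "(p l - cost G l) * partial (mnl_demand \<alpha> G l) j p
        * inverse (partial (mnl_demand \<alpha> G j) j p)
      = - ((p l - cost G l) * mnl_share \<alpha> G p l / (1 - mnl_share \<alpha> G p j))"
      using S nz by (auto simp: partial_mnl_demand[OF G j] subset_iff divide_simps)
  qed simp
  moreover have "mnl_demand \<alpha> G j p * inverse (partial (mnl_demand \<alpha> G j) j p)
    = - (1 / \<alpha>) / (1 - mnl_share \<alpha> G p j)"
    using nz by (simp add: partial_mnl_demand[OF G j j] mnl_demand_eq_share[OF G] divide_simps)
  ultimately show ?thesis
    by (simp add: mnl_foc_def Let_def markup_gap_def sum_negf add_divide_distrib
        flip: sum_divide_distrib)
qed

lemma partial_mnl_foc: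
  assumes G: "wf_game G" and S: "S \<subseteq> products G" "j \<in> S" "k \<in> S" and "\<alpha> \<noteq> 0"
  shows "partial (mnl_foc \<alpha> G S j) k p =
    markup_slope (1 / \<alpha>) 1 1 S (\<lambda>l. p l - cost G l) (mnl_share \<alpha> G p) (- \<alpha>) (\<lambda>_. 1) j k"
proof -
  \<comment> \<open>The base point is written \<open>p(k := p k)\<close> so that margins and shares
    appear as one-parameter families evaluated at \<open>p k\<close>, matching the shape of
    \<open>DERIV_markup_gap\<close>.\<close>
  have "((\<lambda>x. markup_gap (1 / \<alpha>) 1 1 S (\<lambda>l. (p(k := x)) l - cost G l)
      (mnl_share \<alpha> G (p(k := x))) j) has_real_derivative
    markup_slope (1 / \<alpha>) 1 1 S (\<lambda>l. (p(k := p k)) l - cost G l)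
      (mnl_share \<alpha> G (p(k := p k))) (- \<alpha>) (\<lambda>_. 1) j k) (at (p k))"
  proof (rule DERIV_markup_gap)
    show "1 - 1 * mnl_share \<alpha> G (p(k := p k)) j \<noteq> 0"
      using mnl_share_less_1[OF G, of j \<alpha> p] S by auto
  next
    show "((\<lambda>x. (p(k := x)) l - cost G l) has_real_derivative of_bool (l = k) * 1) (at (p k))" for l
      by (rule DERIV_margin[THEN DERIV_cong]) simp
  next
    show "((\<lambda>x. mnl_share \<alpha> G (p(k := x)) l) has_real_derivative
      - \<alpha> * mnl_share \<alpha> G (p(k := p k)) l
        * (of_bool (l = k) - mnl_share \<alpha> G (p(k := p k)) k)) (at (p k))" if "l \<in> S" for l
      unfolding fun_upd_triv by (rule DERIV_mnl_share[OF G]) (use that S in auto)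
  qed (fact S)
  then show ?thesis
    unfolding partial_def mnl_foc_eq_markup_gap[OF G S(1,2) \<open>\<alpha> \<noteq> 0\<close>]
    by (intro DERIV_imp_deriv) simp
qed

lemma mnl_nash_margin:
  assumes G: "wf_game G" and "0 < \<alpha>" and f: "f \<in> firms G"
    and nash: "bertrand_nash (mnl_demand \<alpha> G) G p" and j: "j \<in> owned G f"
  shows "p j - cost G j = (1 / \<alpha>) / (1 - 1 * mnl_firm_share \<alpha> G p f)"
  unfolding mnl_firm_share_def
proof (rule common_margin[where c = 1 and m = "\<lambda>l. p l - cost G l", OF _ _ _ j])
  note owned = wf_game_owned[OF G f]
  show "1 - 1 * (\<Sum>l\<in>owned G f. mnl_share \<alpha> G p l) \<noteq> 0"
    using sum_mnl_share_less_1[OF G owned, of \<alpha> p] by simp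
  fix j assume j: "j \<in> owned G f"
  have "((\<lambda>x. market_size G * (\<Sum>l\<in>owned G f. ((p(j := x)) l - cost G l)
      * mnl_share \<alpha> G (p(j := x)) l)) has_real_derivative
    market_size G * mnl_share \<alpha> G (p(j := p j)) j * (1 + - \<alpha> * ((p(j := p j)) j - cost G j)
      - - \<alpha> * (\<Sum>l\<in>owned G f. ((p(j := p j)) l - cost G l) * mnl_share \<alpha> G (p(j := p j)) l)))
    (at (p j))"
  proof (rule DERIV_margin_times_share)
    show "finite (owned G f)"
      using owned wf_game_finite[OF G] finite_subset by blast
  next
    show "((\<lambda>x. (p(j := x)) l - cost G l) has_real_derivative of_bool (l = j) * 1) (at (p j))" for l
      by (rule DERIV_margin[THEN DERIV_cong]) simp
  next
    show "((\<lambda>x. mnl_share \<alpha> G (p(j := x)) l) has_real_derivative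
      - \<alpha> * mnl_share \<alpha> G (p(j := p j)) l
        * (of_bool (l = j) - mnl_share \<alpha> G (p(j := p j)) j)) (at (p j))" if "l \<in> owned G f" for l
      unfolding fun_upd_triv by (rule DERIV_mnl_share[OF G]) (use that j owned in auto)
  qed (fact j)
  moreover have "profit (mnl_demand \<alpha> G) G f p' =
      market_size G * (\<Sum>l\<in>owned G f. (p' l - cost G l) * mnl_share \<alpha> G p' l)" for p'
    by (simp add: profit_def mnl_demand_eq_share[OF G] sum_distrib_left mult_ac)
  ultimately have "market_size G * mnl_share \<alpha> G p j * (1 + - \<alpha> * (p j - cost G j)
      - - \<alpha> * (\<Sum>l\<in>owned G f. (p l - cost G l) * mnl_share \<alpha> G p l)) = 0"
    by (intro nash_profit_deriv_zero[OF nash f j owned]) (simp only: fun_upd_triv)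
  \<comment> \<open>Market size and the share of \<open>j\<close> are positive and can be
    cancelled.\<close>
  then have "1 + - \<alpha> * (p j - cost G j)
      - - \<alpha> * (\<Sum>l\<in>owned G f. (p l - cost G l) * mnl_share \<alpha> G p l) = 0"
    using wf_game_market_size[OF G] mnl_share_pos[OF G, of \<alpha> p j] by simp
  then show "1 * (p j - cost G j)
      = 1 / \<alpha> + 1 * (\<Sum>l\<in>owned G f. (p l - cost G l) * mnl_share \<alpha> G p l)"
    using \<open>0 < \<alpha>\<close> by (simp add: field_simps)
qed simp

section \<open>CES demand: first-order conditions and equilibrium margins\<close>

text \<open>Multiplying by the price raises the exponent from \<open>- \<sigma>\<close> to
  \<open>1 - \<sigma>\<close>, so revenue shares, unlike quantities, have logit form.\<close>

lemma ces_share_eq: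
  assumes "wf_game G" "0 < p j"
  shows "ces_share \<sigma> G p j = quality G j * p j powr (1 - \<sigma>)
    / (1 + (\<Sum>l\<in>products G. quality G l * p l powr (1 - \<sigma>)))"
proof -
  have "p j powr (1 - \<sigma>) = p j * p j powr (- \<sigma>)"
    using assms(2) by (simp add: powr_diff powr_minus field_simps)
  then show ?thesis
    using wf_game_market_size[OF assms(1)] by (simp add: ces_share_def ces_demand_def)
qed

lemma ces_demand_eq_share:
  assumes "wf_game G" "0 < p j"
  shows "ces_demand \<sigma> G j p = market_size G * ces_share \<sigma> G p j / p j"
  using wf_game_market_size[OF assms(1)] assms(2) by (simp add: ces_share_def)

lemma ces_revenue_eq_share:
  "wf_game G \<Longrightarrow> ces_revenue \<sigma> G j p = market_size G * ces_share \<sigma> G p j"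
  using wf_game_market_size[of G] by (simp add: ces_share_def ces_revenue_def)

context
  fixes G :: "('j, 'f) pricing_game" and p :: "'j \<Rightarrow> real"
  assumes G: "wf_game G" and quality: "\<forall>l\<in>products G. 0 < quality G l"
    and price: "\<forall>l\<in>products G. 0 < p l"
begin

lemma ces_share_pos:
  assumes "l \<in> products G"
  shows "0 < ces_share \<sigma> G p l"
proof -
  have "0 \<le> (\<Sum>l\<in>products G. quality G l * p l powr (1 - \<sigma>))"
    using quality by (intro sum_nonneg) (simp add: less_imp_le)
  then show ?thesis
    using assms quality price by (auto simp: ces_share_eq[OF G] intro!: divide_pos_pos)
qed

lemma sum_ces_share_less_1:
  assumes "F \<subseteq> products G"
  shows "(\<Sum>l\<in>F. ces_share \<sigma> G p l) < 1"
proof -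
  have "(\<Sum>l\<in>F. ces_share \<sigma> G p l) = (\<Sum>l\<in>F. quality G l * p l powr (1 - \<sigma>)
    / (1 + (\<Sum>l\<in>products G. quality G l * p l powr (1 - \<sigma>))))"
    using price assms by (intro sum.cong) (auto simp: ces_share_eq[OF G])
  also have "\<dots> < 1"
    by (rule sum_logit_share_less_1)
      (use quality assms wf_game_finite[OF G] in \<open>auto simp: less_imp_le\<close>)
  finally show ?thesis .
qed

lemma ces_share_less_1: "l \<in> products G \<Longrightarrow> ces_share \<sigma> G p l < 1"
  using sum_ces_share_less_1[of "{l}"] by simp

lemma DERIV_ces_share:
  assumes "k \<in> products G" "l \<in> products G"
  shows "((\<lambda>x. ces_share \<sigma> G (p(k := x)) l) has_real_derivative
    (1 - \<sigma>) / p k * ces_share \<sigma> G p l * (of_bool (l = k) - ces_share \<sigma> G p k)) (at (p k))"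
\<comment> \<open>The logit form of the share is available only for positive prices, so the
  derivative is transferred along the open half-line around \<open>p k\<close>.\<close>
proof (rule has_field_derivative_transform_within_open)
  let ?W = "\<lambda>l x. quality G l * (p(k := x)) l powr (1 - \<sigma>)"
  have pos: "0 < p l" if "l \<in> products G" for l
    using price that by auto
  have "((\<lambda>x. quality G k * x powr (1 - \<sigma>)) has_real_derivative
    (1 - \<sigma>) / p k * (quality G k * p k powr (1 - \<sigma>))) (at (p k))"
    using DERIV_cmult[OF has_real_derivative_powr[OF pos[OF assms(1)], of "1 - \<sigma>"]]
      powr_diff[of "p k" "1 - \<sigma>" 1] pos[OF assms(1)]
    by (simp add: mult_ac)
  then have "(?W l has_real_derivative of_bool (l = k) * ((1 - \<sigma>) / p k * ?W k (p k))) (at (p k))" for l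
    by (cases "l = k") auto
  from DERIV_logit_share[OF wf_game_finite[OF G] assms this]
  show "((\<lambda>x. ?W l x / (1 + (\<Sum>i\<in>products G. ?W i x))) has_real_derivative
    (1 - \<sigma>) / p k * ces_share \<sigma> G p l * (of_bool (l = k) - ces_share \<sigma> G p k)) (at (p k))"
    using pos assms quality by (simp add: ces_share_eq[OF G] less_imp_le)
  show "?W l x / (1 + (\<Sum>i\<in>products G. ?W i x)) = ces_share \<sigma> G (p(k := x)) l"
    if "x \<in> {0<..}" for x
    using that pos[OF assms(2)] by (subst ces_share_eq[OF G]) auto
qed (use price assms in auto)

lemma partial_ces_revenue:
  assumes "k \<in> products G" "l \<in> products G"
  shows "partial (ces_revenue \<sigma> G l) k p =
    market_size G * ((1 - \<sigma>) / p k * ces_share \<sigma> G p l * (of_bool (l = k) - ces_share \<sigma> G p k))"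
  unfolding partial_def ces_revenue_eq_share[OF G]
  by (intro DERIV_imp_deriv DERIV_cmult DERIV_ces_share assms)

text \<open>Quantity is proportional to revenue share over price, so its elasticity is that of the
  share, \<open>(1 - \<sigma>)\<close> times one minus the share, less 1.\<close>

lemma ces_own_elasticity_eq:
  assumes j: "j \<in> products G"
  shows "ces_own_elasticity \<sigma> G j p = - (\<sigma> - (\<sigma> - 1) * ces_share \<sigma> G p j)"
proof -
  have pj: "0 < p j" using price j by auto
  let ?s = "ces_share \<sigma> G p j"
  have "((\<lambda>x. ces_demand \<sigma> G j (p(j := x))) has_real_derivative
    market_size G * ?s / (p j)\<^sup>2 * ((1 - \<sigma>) * (1 - ?s) - 1)) (at (p j))"
  proof (rule has_field_derivative_transform_within_open)
    show "((\<lambda>x. market_size G * ces_share \<sigma> G (p(j := x)) j / x) has_real_derivative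
      market_size G * ?s / (p j)\<^sup>2 * ((1 - \<sigma>) * (1 - ?s) - 1)) (at (p j))"
      using pj by (auto intro!: derivative_eq_intros DERIV_ces_share j
          simp: field_simps power2_eq_square)
    show "market_size G * ces_share \<sigma> G (p(j := x)) j / x = ces_demand \<sigma> G j (p(j := x))"
      if "x \<in> {0<..}" for x
      using that by (subst ces_demand_eq_share[OF G]) auto
  qed (use pj in auto)
  then have "partial (ces_demand \<sigma> G j) j p
      = market_size G * ?s / (p j)\<^sup>2 * ((1 - \<sigma>) * (1 - ?s) - 1)"
    unfolding partial_def by (rule DERIV_imp_deriv)
  then have "ces_own_elasticity \<sigma> G j p = (1 - \<sigma>) * (1 - ?s) - 1"
    using pj wf_game_market_size[OF G] ces_share_pos[OF j, of \<sigma>]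
    by (simp add: ces_own_elasticity_def ces_demand_eq_share[OF G] power2_eq_square)
  then show ?thesis
    by (simp add: algebra_simps)
qed

text \<open>For \<open>F = {j}\<close> this quantity is minus the own elasticity of
  \<open>j\<close>; for \<open>F\<close> the products of a firm it is the reciprocal of the
  equilibrium margin.\<close>

lemma ces_elasticity_pos:
  assumes "F \<subseteq> products G" "1 < \<sigma>"
  shows "0 < \<sigma> - (\<sigma> - 1) * (\<Sum>l\<in>F. ces_share \<sigma> G p l)"
proof -
  have "(\<sigma> - 1) * (\<Sum>l\<in>F. ces_share \<sigma> G p l) < (\<sigma> - 1) * 1"
    using sum_ces_share_less_1[OF assms(1)] assms(2) by (intro mult_strict_left_mono) auto
  then show ?thesis by simp
qed

text \<open>Revenue diversion from \<open>j\<close> to \<open>l\<close> is the share of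
  \<open>l\<close> over one minus the share of \<open>j\<close>. The factor
  \<open>1 + inverse\<close> of the own elasticity contains one minus the share of \<open>j\<close>
  in its numerator, and the two cancel.\<close>

lemma ces_foc_eq_markup_gap:
  assumes S: "S \<subseteq> products G" "j \<in> S" and "1 < \<sigma>"
  shows "ces_foc \<sigma> G S j p =
    markup_gap 1 (\<sigma> - 1) \<sigma> S (\<lambda>l. rel_margin G l p) (ces_share \<sigma> G p) j"
proof -
  have j: "j \<in> products G" using S by auto
  let ?s = "ces_share \<sigma> G p" let ?E = "\<sigma> - (\<sigma> - 1) * ?s j"
  let ?W = "\<Sum>l\<in>S - {j}. rel_margin G l p * ?s l"
  have E: "0 < ?E" using ces_elasticity_pos[of "{j}"] j \<open>1 < \<sigma>\<close> by simp
  have s: "1 - ?s j \<noteq> 0" using ces_share_less_1[OF j, of \<sigma>] by simp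
  have div: "ces_revenue_diversion \<sigma> G j l p = ?s l / (1 - ?s j)" if "l \<in> S - {j}" for l
  proof -
    have l: "l \<in> products G" "l \<noteq> j" using that S by auto
    \<comment> \<open>The factor common to the own and cross revenue derivatives; it drops out of
      the diversion ratio.\<close>
    define C where "C = market_size G * ((1 - \<sigma>) / p j * ?s j)"
    have "C \<noteq> 0"
      using price j wf_game_market_size[OF G] ces_share_pos[OF j, of \<sigma>] \<open>1 < \<sigma>\<close>
      by (auto simp: C_def)
    moreover have "partial (ces_revenue \<sigma> G l) j p = - C * ?s l"
      "partial (ces_revenue \<sigma> G j) j p = C * (1 - ?s j)"
      using l j by (simp_all add: partial_ces_revenue C_def)
    ultimately show ?thesis
      by (simp add: ces_revenue_diversion_def)
  qed
  have sum: "(\<Sum>l\<in>S - {j}. rel_margin G l p * ces_revenue_diversion \<sigma> G j l p) = ?W / (1 - ?s j)"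
    unfolding sum_divide_distrib by (rule sum.cong) (simp_all add: div)
  have inv: "1 + inverse (- ?E) = (\<sigma> - 1) * (1 - ?s j) / ?E"
    using E by (simp add: field_simps)
  have "ces_foc \<sigma> G S j p
      = inverse ?E - rel_margin G j p + (\<sigma> - 1) * (1 - ?s j) / ?E * (?W / (1 - ?s j))"
    unfolding ces_foc_def ces_own_elasticity_eq[OF j] sum inv
    by (simp only: inverse_minus_eq minus_minus)
  also have "(\<sigma> - 1) * (1 - ?s j) / ?E * (?W / (1 - ?s j)) = (\<sigma> - 1) * ?W / ?E"
    using s by simp
  finally show ?thesis
    by (simp add: markup_gap_def add_divide_distrib inverse_eq_divide)
qed

lemma DERIV_rel_margin:
  assumes "k \<in> products G"
  shows "((\<lambda>x. rel_margin G l (p(k := x))) has_real_derivative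
    of_bool (l = k) * (cost G k / (p k)\<^sup>2)) (at (p k))"
proof (cases "l = k")
  case True
  have "0 < p k" using price assms by auto
  then have "((\<lambda>x. (x - cost G k) / x) has_real_derivative cost G k / (p k)\<^sup>2) (at (p k))"
    by (auto intro!: derivative_eq_intros simp: power2_eq_square field_simps)
  then show ?thesis
    using True by (simp add: rel_margin_def)
qed (simp add: rel_margin_def)

lemma ces_nash_margin:
  assumes "1 < \<sigma>" and f: "f \<in> firms G"
    and nash: "bertrand_nash (ces_demand \<sigma> G) G p" and j: "j \<in> owned G f"
  shows "rel_margin G j p = 1 / (\<sigma> - (\<sigma> - 1) * ces_firm_share \<sigma> G p f)"
  unfolding ces_firm_share_def
proof (rule common_margin[where m = "\<lambda>l. rel_margin G l p", OF _ _ _ j])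
  note owned = wf_game_owned[OF G f]
  show "\<sigma> - (\<sigma> - 1) * (\<Sum>l\<in>owned G f. ces_share \<sigma> G p l) \<noteq> 0"
    using ces_elasticity_pos[OF owned \<open>1 < \<sigma>\<close>] by simp
  show "\<sigma> \<noteq> 0" using \<open>1 < \<sigma>\<close> by simp
  fix j assume j: "j \<in> owned G f"
  have jP: "j \<in> products G" and pj: "0 < p j" using j owned price by auto
  let ?X = "\<Sum>l\<in>owned G f. rel_margin G l p * ces_share \<sigma> G p l"
  have "((\<lambda>x. market_size G * (\<Sum>l\<in>owned G f. rel_margin G l (p(j := x))
      * ces_share \<sigma> G (p(j := x)) l)) has_real_derivative
    market_size G * ces_share \<sigma> G (p(j := p j)) j
      * (cost G j / (p j)\<^sup>2 + (1 - \<sigma>) / p j * rel_margin G j (p(j := p j))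
      - (1 - \<sigma>) / p j * (\<Sum>l\<in>owned G f. rel_margin G l (p(j := p j))
        * ces_share \<sigma> G (p(j := p j)) l)))
    (at (p j))"
  proof (rule DERIV_margin_times_share)
    show "finite (owned G f)"
      using owned wf_game_finite[OF G] finite_subset by blast
  next
    show "((\<lambda>x. rel_margin G l (p(j := x))) has_real_derivative
      of_bool (l = j) * (cost G j / (p j)\<^sup>2)) (at (p j))" for l
      using DERIV_rel_margin[OF jP] .
  next
    show "((\<lambda>x. ces_share \<sigma> G (p(j := x)) l) has_real_derivative
      (1 - \<sigma>) / p j * ces_share \<sigma> G (p(j := p j)) l
        * (of_bool (l = j) - ces_share \<sigma> G (p(j := p j)) j)) (at (p j))" if "l \<in> owned G f" for l
      unfolding fun_upd_triv by (rule DERIV_ces_share) (use that jP owned in auto)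
  qed (fact j)
  \<comment> \<open>A product's profit is its relative margin times its revenue only where its price
    is nonzero, so the derivative is again transferred on the positive half-line.\<close>
  then have "((\<lambda>x. profit (ces_demand \<sigma> G) G f (p(j := x))) has_real_derivative
    market_size G * ces_share \<sigma> G p j
      * (cost G j / (p j)\<^sup>2 + (1 - \<sigma>) / p j * rel_margin G j p - (1 - \<sigma>) / p j * ?X)) (at (p j))"
    unfolding fun_upd_triv
  proof (rule has_field_derivative_transform_within_open[of _ _ _ "{0<..}"])
    fix x :: real assume "x \<in> {0<..}"
    then have "0 < (p(j := x)) l" if "l \<in> owned G f" for l
      using that owned price by auto
    then show "market_size G * (\<Sum>l\<in>owned G f. rel_margin G l (p(j := x))
        * ces_share \<sigma> G (p(j := x)) l) = profit (ces_demand \<sigma> G) G f (p(j := x))"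
      unfolding profit_def sum_distrib_left
      by (intro sum.cong refl)
        (simp only: ces_demand_eq_share[OF G] rel_margin_def times_divide_eq_right
          times_divide_eq_left mult_ac)
  qed (use pj in auto)
  from nash_profit_deriv_zero[OF nash f j owned this]
  have "cost G j / (p j)\<^sup>2 + (1 - \<sigma>) / p j * rel_margin G j p - (1 - \<sigma>) / p j * ?X = 0"
    using wf_game_market_size[OF G] ces_share_pos[OF jP, of \<sigma>] by simp
  \<comment> \<open>Multiplying by the price leaves the ratio of cost to price, which is one minus
    the relative margin; this adds one more margin and turns the coefficient
    \<open>\<sigma> - 1\<close> into \<open>\<sigma>\<close>.\<close>
  then have "p j * (cost G j / (p j)\<^sup>2 + (1 - \<sigma>) / p j * rel_margin G j p
      - (1 - \<sigma>) / p j * ?X) = 0"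
    by simp
  then have "cost G j / p j + (1 - \<sigma>) * rel_margin G j p - (1 - \<sigma>) * ?X = 0"
    using pj by (simp add: distrib_left right_diff_distrib power2_eq_square)
  moreover have "cost G j / p j = 1 - rel_margin G j p"
    using pj by (simp add: rel_margin_def field_simps)
  ultimately show "\<sigma> * rel_margin G j p = 1 + (\<sigma> - 1) * ?X"
    by (simp add: algebra_simps)
qed

end

section \<open>CES Jacobian in log prices\<close>

text \<open>The vectors \<open>\<lambda>l. exp (ln (p l))\<close> and \<open>p\<close> may differ
  outside \<open>products G\<close>, where prices need not be positive, so the agreement is checked
  on the products that enter the share.\<close>

lemma ces_share_exp_ln:
  assumes "wf_game G" "\<forall>l\<in>products G. 0 < p l" "j \<in> products G"
  shows "ces_share \<sigma> G (\<lambda>l. exp (ln (p l))) j = ces_share \<sigma> G p j"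
proof -
  have "(\<Sum>l\<in>products G. quality G l * exp (ln (p l)) powr (1 - \<sigma>))
    = (\<Sum>l\<in>products G. quality G l * p l powr (1 - \<sigma>))"
    using assms(2) by (intro sum.cong) auto
  then show ?thesis
    using assms by (simp add: ces_share_eq)
qed

text \<open>The chain rule multiplies price derivatives by \<open>p k\<close>. The rate
  \<open>(1 - \<sigma>) / p k\<close> thereby becomes the constant \<open>1 - \<sigma>\<close>, and
  the margin derivative, cost over squared price, becomes cost over price, that is, one minus the
  relative margin.\<close>

lemma partial_log_ces_foc:
  assumes G: "wf_game G" and quality: "\<forall>l\<in>products G. 0 < quality G l"
    and S: "S \<subseteq> products G" "j \<in> S" "k \<in> S" and "1 < \<sigma>"
  shows "partial (\<lambda>t. ces_foc \<sigma> G S j (\<lambda>l. exp (t l))) k t =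
    markup_slope 1 (\<sigma> - 1) \<sigma> S (\<lambda>l. rel_margin G l (\<lambda>l. exp (t l)))
      (ces_share \<sigma> G (\<lambda>l. exp (t l))) (1 - \<sigma>) (\<lambda>l. 1 - rel_margin G l (\<lambda>l. exp (t l))) j k"
proof -
  define p where "p = (\<lambda>l. exp (t l))"
  have upd: "(\<lambda>l. exp ((t(k := x)) l)) = p(k := exp x)" for x
    by (auto simp: p_def)
  have p: "\<forall>l\<in>products G. 0 < p l" "\<forall>l\<in>products G. 0 < (p(k := exp x)) l" for x
    by (auto simp: p_def)
  have kP: "k \<in> products G" and pk: "exp (t k) = p k" "0 < p k"
    using S by (auto simp: p_def)
  have chain: "((\<lambda>x. f (exp x)) has_real_derivative d * p k) (at (t k))"
    if "(f has_real_derivative d) (at (p k))" for f d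
    using DERIV_chain2[of f d exp "t k", OF _ DERIV_exp] that by (simp add: pk)
  have "((\<lambda>x. markup_gap 1 (\<sigma> - 1) \<sigma> S (\<lambda>l. rel_margin G l (p(k := exp x)))
      (ces_share \<sigma> G (p(k := exp x))) j) has_real_derivative
    markup_slope 1 (\<sigma> - 1) \<sigma> S (\<lambda>l. rel_margin G l (p(k := exp (t k))))
      (ces_share \<sigma> G (p(k := exp (t k)))) (1 - \<sigma>) (\<lambda>l. 1 - rel_margin G l p) j k) (at (t k))"
  proof (rule DERIV_markup_gap)
    show "((\<lambda>x. ces_share \<sigma> G (p(k := exp x)) l) has_real_derivative
      (1 - \<sigma>) * ces_share \<sigma> G (p(k := exp (t k))) l
        * (of_bool (l = k) - ces_share \<sigma> G (p(k := exp (t k))) k)) (at (t k))" if "l \<in> S" for l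
    proof -
      have "l \<in> products G" using that S by auto
      from chain[OF DERIV_ces_share[OF G quality p(1) kP this, of \<sigma>]]
      show ?thesis
        using pk by (simp del: of_bool_eq)
    qed
    show "((\<lambda>x. rel_margin G l (p(k := exp x))) has_real_derivative
      of_bool (l = k) * (1 - rel_margin G l p)) (at (t k))" for l
    proof -
      have "of_bool (l = k) * (cost G k / (p k)\<^sup>2) * p k = of_bool (l = k) * (1 - rel_margin G l p)"
        using pk by (cases "l = k") (simp_all add: rel_margin_def power2_eq_square field_simps)
      then show ?thesis
        using chain[OF DERIV_rel_margin[OF G quality p(1) kP, of l]] by simp
    qed
    show "\<sigma> - (\<sigma> - 1) * ces_share \<sigma> G (p(k := exp (t k))) j \<noteq> 0"
      using ces_elasticity_pos[OF G quality p(1), of "{j}" \<sigma>] S \<open>1 < \<sigma>\<close> pk by auto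
  qed (fact S)
  then show ?thesis
    unfolding partial_def upd ces_foc_eq_markup_gap[OF G quality p(2) S(1,2) \<open>1 < \<sigma>\<close>]
    by (intro DERIV_imp_deriv) (simp add: pk flip: p_def)
qed

section \<open>Limits along a sequence of games with vanishing shares\<close>

text \<open>Only firm totals are assumed to vanish; nonnegativity squeezes each product's share
  between 0 and its firm's total.\<close>

lemma tendsto_member_zero:
  fixes s :: "nat \<Rightarrow> 'j \<Rightarrow> real"
  assumes lim: "(\<lambda>n. \<Sum>l\<in>F. s n l) \<longlonglongrightarrow> 0"
    and "finite F" "j \<in> F" "\<And>n l. l \<in> F \<Longrightarrow> 0 \<le> s n l"
  shows "(\<lambda>n. s n j) \<longlonglongrightarrow> 0"
proof (rule tendsto_sandwich[OF _ _ tendsto_const lim])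
  show "\<forall>\<^sub>F n in sequentially. 0 \<le> s n j"
    using assms by simp
  show "\<forall>\<^sub>F n in sequentially. s n j \<le> (\<Sum>l\<in>F. s n l)"
    using assms by (intro always_eventually allI member_le_sum) auto
qed

context
  fixes JA JB :: "'j set" and A B :: 'f and e :: "'m::finite \<Rightarrow> 'j"
    and G :: "nat \<Rightarrow> ('j, 'f) pricing_game" and p :: "nat \<Rightarrow> 'j \<Rightarrow> real"
  assumes fin: "finite JA" "finite JB" and e: "bij_betw e UNIV (JA \<union> JB)"
    and wf: "\<And>n. wf_game (G n)"
    and A: "\<And>n. A \<in> firms (G n)" "\<And>n. owned (G n) A = JA"
    and B: "\<And>n. B \<in> firms (G n)" "\<And>n. owned (G n) B = JB"
begin

lemma range_e: "range e = JA \<union> JB" and inj_e: "inj e"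
  using e by (auto simp: bij_betw_def)

lemma merging_products: "JA \<subseteq> products (G n)" "JB \<subseteq> products (G n)" "range e \<subseteq> products (G n)"
  using wf_game_owned[OF wf A(1)] wf_game_owned[OF wf B(1)] A(2) B(2) range_e by auto

lemma mnl_pass_through_limit:
  assumes "0 < \<alpha>" and nash: "\<And>n. bertrand_nash (mnl_demand \<alpha> (G n)) (G n) (p n)"
    and sA: "(\<lambda>n. mnl_firm_share \<alpha> (G n) (p n) A) \<longlonglongrightarrow> 0"
    and sB: "(\<lambda>n. mnl_firm_share \<alpha> (G n) (p n) B) \<longlonglongrightarrow> 0"
  shows "(\<forall>\<^sub>F n in sequentially. invertible (mnl_jacobian \<alpha> (G n) e (p n))) \<and>
    (\<lambda>n. mnl_pass_through \<alpha> (G n) e (p n)) \<longlonglongrightarrow> mat 1"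
proof -
  \<comment> \<open>Here \<open>\<mu>' = 1\<close>, because an absolute margin moves one for one
    with its own price.\<close>
  have "(\<forall>\<^sub>F n in sequentially. invertible (mnl_jacobian \<alpha> (G n) e (p n))) \<and>
    (\<lambda>n. - matrix_inv (mnl_jacobian \<alpha> (G n) e (p n))) \<longlonglongrightarrow> (1 / 1) *\<^sub>R mat 1"
  proof (rule pass_through_limit)
    show "mnl_jacobian \<alpha> (G n) e (p n) $ i $ k = markup_slope (1 / \<alpha>) 1 1 (range e)
        (\<lambda>l. p n l - cost (G n) l) (mnl_share \<alpha> (G n) (p n)) (- \<alpha>) (\<lambda>_. 1) (e i) (e k)" for n i k
      using merging_products(3) \<open>0 < \<alpha>\<close> by (simp add: mnl_jacobian_def partial_mnl_foc wf)
    show "(\<lambda>n. mnl_share \<alpha> (G n) (p n) l) \<longlonglongrightarrow> 0" if "l \<in> range e" for l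
      using that sA sB fin unfolding range_e mnl_firm_share_def A(2) B(2)
      by (auto intro: tendsto_member_zero simp: mnl_share_pos[OF wf] less_imp_le)
    \<comment> \<open>Each equilibrium margin is a function of its firm's share alone, continuous at
      share 0. Costs and rivals may therefore vary freely along the sequence.\<close>
    have "(\<lambda>n. (1 / \<alpha>) / (1 - 1 * mnl_firm_share \<alpha> (G n) (p n) A)) \<longlonglongrightarrow> 1 / \<alpha>"
      "(\<lambda>n. (1 / \<alpha>) / (1 - 1 * mnl_firm_share \<alpha> (G n) (p n) B)) \<longlonglongrightarrow> 1 / \<alpha>"
      using \<open>0 < \<alpha>\<close> by (auto intro!: tendsto_eq_intros sA sB)
    then show "(\<lambda>n. p n l - cost (G n) l) \<longlonglongrightarrow> 1 / \<alpha>" if "l \<in> range e" for l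
      using that mnl_nash_margin[OF wf \<open>0 < \<alpha>\<close> A(1) nash] mnl_nash_margin[OF wf \<open>0 < \<alpha>\<close> B(1) nash]
      unfolding range_e A(2) B(2) by auto
  qed (use inj_e in auto)
  then show ?thesis
    by (simp add: mnl_pass_through_def)
qed

lemma ces_pass_through_limit:
  assumes "1 < \<sigma>" and quality: "\<And>n. \<forall>l\<in>products (G n). 0 < quality (G n) l"
    and nash: "\<And>n. bertrand_nash (ces_demand \<sigma> (G n)) (G n) (p n)"
    and sA: "(\<lambda>n. ces_firm_share \<sigma> (G n) (p n) A) \<longlonglongrightarrow> 0"
    and sB: "(\<lambda>n. ces_firm_share \<sigma> (G n) (p n) B) \<longlonglongrightarrow> 0"
  shows "(\<forall>\<^sub>F n in sequentially. invertible (ces_jacobian \<sigma> (G n) e (p n))) \<and>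
    (\<lambda>n. ces_pass_through \<sigma> (G n) e (p n)) \<longlonglongrightarrow> (\<sigma> / (\<sigma> - 1)) *\<^sub>R mat 1"
proof -
  have price: "\<forall>l\<in>products (G n). 0 < p n l" for n
    using nash[of n] by (simp add: bertrand_nash_def)
  \<comment> \<open>The Jacobian is evaluated through log prices, hence at \<open>?p\<close>,
    whereas the equilibrium is stated at \<open>p\<close>; margins and shares of the merging
    products agree at both.\<close>
  let ?p = "\<lambda>n l. exp (ln (p n l))"
  have p_eq: "?p n l = p n l" if "l \<in> range e" for n l
    using price[of n] merging_products(3)[of n] that by (intro exp_ln) auto
  then have margin_eq: "rel_margin (G n) l (?p n) = rel_margin (G n) l (p n)" if "l \<in> range e" for n l
    using that by (simp only: rel_margin_def)
  have share_eq: "ces_share \<sigma> (G n) (?p n) l = ces_share \<sigma> (G n) (p n) l" if "l \<in> range e" for n l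
    using merging_products(3)[of n] that by (intro ces_share_exp_ln wf price) auto
  have margin: "(\<lambda>n. rel_margin (G n) l (?p n)) \<longlonglongrightarrow> 1 / \<sigma>" if "l \<in> range e" for l
  proof -
    have "(\<lambda>n. 1 / (\<sigma> - (\<sigma> - 1) * ces_firm_share \<sigma> (G n) (p n) A)) \<longlonglongrightarrow> 1 / \<sigma>"
      "(\<lambda>n. 1 / (\<sigma> - (\<sigma> - 1) * ces_firm_share \<sigma> (G n) (p n) B)) \<longlonglongrightarrow> 1 / \<sigma>"
      using \<open>1 < \<sigma>\<close> by (auto intro!: tendsto_eq_intros sA sB)
    then show ?thesis
      using that ces_nash_margin[OF wf quality price \<open>1 < \<sigma>\<close> A(1) nash]
        ces_nash_margin[OF wf quality price \<open>1 < \<sigma>\<close> B(1) nash]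
      unfolding margin_eq[OF that] unfolding range_e A(2) B(2) by auto
  qed
  \<comment> \<open>Here \<open>\<mu>'\<close> is \<open>1 - 1 / \<sigma>\<close>, since a relative
    margin \<open>m\<close> has log-price derivative \<open>1 - m\<close> and tends to
    \<open>1 / \<sigma>\<close>.\<close>
  have "(\<forall>\<^sub>F n in sequentially. invertible (ces_jacobian \<sigma> (G n) e (p n))) \<and>
    (\<lambda>n. - matrix_inv (ces_jacobian \<sigma> (G n) e (p n))) \<longlonglongrightarrow> (1 / (1 - 1 / \<sigma>)) *\<^sub>R mat 1"
  proof (rule pass_through_limit)
    show "ces_jacobian \<sigma> (G n) e (p n) $ i $ k = markup_slope 1 (\<sigma> - 1) \<sigma> (range e)
        (\<lambda>l. rel_margin (G n) l (?p n)) (ces_share \<sigma> (G n) (?p n)) (1 - \<sigma>)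
        (\<lambda>l. 1 - rel_margin (G n) l (?p n)) (e i) (e k)" for n i k
      using merging_products(3) \<open>1 < \<sigma>\<close>
      by (simp add: ces_jacobian_def partial_log_ces_foc[OF wf quality])
    show "(\<lambda>n. ces_share \<sigma> (G n) (?p n) l) \<longlonglongrightarrow> 0" if "l \<in> range e" for l
    proof -
      have pos: "0 \<le> ces_share \<sigma> (G n) (p n) l" if "l \<in> JA \<union> JB" for n l
        using that merging_products[of n] by (intro less_imp_le ces_share_pos wf quality price) auto
      show ?thesis
        using that sA sB fin pos unfolding share_eq[OF that] unfolding range_e ces_firm_share_def A(2) B(2)
        by (auto intro: tendsto_member_zero)
    qed
    show "(\<lambda>n. 1 - rel_margin (G n) l (?p n)) \<longlonglongrightarrow> 1 - 1 / \<sigma>" if "l \<in> range e" for l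
      by (intro tendsto_intros margin that)
  qed (use inj_e margin \<open>1 < \<sigma>\<close> in auto)
  moreover have "1 / (1 - 1 / \<sigma>) = \<sigma> / (\<sigma> - 1)"
    using \<open>1 < \<sigma>\<close> by (simp add: field_simps)
  ultimately show ?thesis
    by (simp add: ces_pass_through_def)
qed

end

theorem lemma1:
  fixes JA JB :: "'j set"
    and A B :: 'f
    and e :: "'m::finite \<Rightarrow> 'j"
    and G :: "nat \<Rightarrow> ('j, 'f) pricing_game"
    and p :: "nat \<Rightarrow> 'j \<Rightarrow> real"
    and \<alpha> \<sigma> :: real
  assumes "finite JA" "JA \<noteq> {}" "finite JB" "JB \<noteq> {}" "JA \<inter> JB = {}"
    and "bij_betw e UNIV (JA \<union> JB)"
    and "0 < \<alpha>" and "1 < \<sigma>"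
    and "A \<noteq> B"
    and "\<And>n. wf_game (G n)"
    and "\<And>n. A \<in> firms (G n)" "\<And>n. owned (G n) A = JA"
    and "\<And>n. B \<in> firms (G n)" "\<And>n. owned (G n) B = JB"
  shows
    "((\<forall>n. bertrand_nash (mnl_demand \<alpha> (G n)) (G n) (p n)) \<and>
      (\<lambda>n. mnl_firm_share \<alpha> (G n) (p n) A) \<longlonglongrightarrow> 0 \<and>
      (\<lambda>n. mnl_firm_share \<alpha> (G n) (p n) B) \<longlonglongrightarrow> 0
      \<longrightarrow>
      (\<forall>\<^sub>F n in sequentially. invertible (mnl_jacobian \<alpha> (G n) e (p n))) \<and>
      (\<lambda>n. mnl_pass_through \<alpha> (G n) e (p n)) \<longlonglongrightarrow> mat 1)
     \<and>
     ((\<forall>n. \<forall>l\<in>products (G n). 0 < quality (G n) l) \<and>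
      (\<forall>n. bertrand_nash (ces_demand \<sigma> (G n)) (G n) (p n)) \<and>
      (\<lambda>n. ces_firm_share \<sigma> (G n) (p n) A) \<longlonglongrightarrow> 0 \<and>
      (\<lambda>n. ces_firm_share \<sigma> (G n) (p n) B) \<longlonglongrightarrow> 0
      \<longrightarrow>
      (\<forall>\<^sub>F n in sequentially. invertible (ces_jacobian \<sigma> (G n) e (p n))) \<and>
      (\<lambda>n. ces_pass_through \<sigma> (G n) e (p n)) \<longlonglongrightarrow> (\<sigma> / (\<sigma> - 1)) *\<^sub>R mat 1)"
  using mnl_pass_through_limit[where G = G and p = p, OF assms(1,3,6,10-14) \<open>0 < \<alpha>\<close>]
    ces_pass_through_limit[where G = G and p = p, OF assms(1,3,6,10-14) \<open>1 < \<sigma>\<close>]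
  by blast

end
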